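(* Let $B\in\mathbb{DQ}^{m\times n}$ be a dual quaternion matrix with $B_{st}\neq O$, and let $A=B^*B$. Then $A$ is a perfect Hermitian matrix; that is, $A$ is a positive semidefinite dual quaternion Hermitian matrix and there is a positive semidefinite dual quaternion Hermitian matrix $L\in\mathbb{DQ}^{n\times n}$ such that $A=L^2$.
   Context: $\mathbb{Q}$ denotes the real quaternions and $q^*$ the quaternion conjugate. $\epsilon$ is the infinitesimal unit: $\epsilon\neq 0$, $\epsilon^2=0$, and $\epsilon$ commutes with all quaternions. A dual number is $q_{st}+q_{\mathcal I}\epsilon$ with $q_{st},q_{\mathcal I}\in\mathbb{R}$. A dual quaternion is $q=q_{st}+q_{\mathcal I}\epsilon$ with $q_{st},q_{\mathcal I}\in\mathbb{Q}$ (set $\mathbb{DQ}$), with conjugate $q^*=q_{st}^*+q_{\mathcal I}^*\epsilon$. A matrix over $\mathbb{DQ}$ is written $B=B_{st}+B_{\mathcal I}\epsilon$ with quaternion matrices $B_{st},B_{\mathcal I}$; $^*$ denotes conjugate transpose; a square matrix $A$ is Hermitian if $A^*=A$. Total order on dual numbers: $p\le q$ iff $p_{st}<q_{st}$, or $p_{st}=q_{st}$ and $p_{\mathcal I}\le q_{\mathcal I}$. For Hermitian $A\in\mathbb{DQ}^{n\times n}$, $\mathbf{x}^*A\mathbf{x}$ is always a dual number; $A$ is positive semidefinite if $\mathbf{x}^*A\mathbf{x}\ge0$ for all $\mathbf{x}\in\mathbb{DQ}^n$. A positive semidefinite Hermitian $M\in\mathbb{DQ}^{n\times n}$ is called perfect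 Hermitian if $M=L^2$ for some positive semidefinite Hermitian $L\in\mathbb{DQ}^{n\times n}$. *)

theory Defs
  imports "HOL-Analysis.Analysis"
begin

section \<open>Real quaternions\<close>

datatype quat = Quat (q_re: real) (q_i: real) (q_j: real) (q_k: real)

instantiation quat :: ring_1
begin

definition zero_quat :: quat where "0 = Quat 0 0 0 0"

definition one_quat :: quat where "1 = Quat 1 0 0 0"

definition plus_quat :: "quat \<Rightarrow> quat \<Rightarrow> quat" where
  "p + q = Quat (q_re p + q_re q) (q_i p + q_i q) (q_j p + q_j q) (q_k p + q_k q)"

definition uminus_quat :: "quat \<Rightarrow> quat" where
  "- q = Quat (- q_re q) (- q_i q) (- q_j q) (- q_k q)"

definition minus_quat :: "quat \<Rightarrow> quat \<Rightarrow> quat" where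
  "p - q = Quat (q_re p - q_re q) (q_i p - q_i q) (q_j p - q_j q) (q_k p - q_k q)"

definition times_quat :: "quat \<Rightarrow> quat \<Rightarrow> quat" where
  "p * q = Quat
     (q_re p * q_re q - q_i p * q_i q - q_j p * q_j q - q_k p * q_k q)
     (q_re p * q_i q + q_i p * q_re q + q_j p * q_k q - q_k p * q_j q)
     (q_re p * q_j q - q_i p * q_k q + q_j p * q_re q + q_k p * q_i q)
     (q_re p * q_k q + q_i p * q_j q - q_j p * q_i q + q_k p * q_re q)"

instance
  by standard
    (simp_all add: zero_quat_def one_quat_def plus_quat_def uminus_quat_def
      minus_quat_def times_quat_def quat.expand algebra_simps)

end

definition quat_of_real :: "real \<Rightarrow> quat" where
  "quat_of_real r = Quat r 0 0 0"

definition quat_cnj :: "quat \<Rightarrow> quat" where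
  "quat_cnj q = Quat (q_re q) (- q_i q) (- q_j q) (- q_k q)"


section \<open>Dual numbers and dual quaternions\<close>

text \<open>\<open>Dual a b\<close> stands for \<open>a + b \<epsilon>\<close>. Dual numbers have real coefficients and
  dual quaternions have quaternion coefficients.\<close>

datatype 'a dual_over = Dual (std_part: 'a) (inf_part: 'a)

type_synonym dual_number = "real dual_over"
type_synonym dual_quat = "quat dual_over"

instantiation dual_over :: (ring_1) ring_1
begin

definition zero_dual_over :: "'a dual_over" where "0 = Dual 0 0"

definition one_dual_over :: "'a dual_over" where "1 = Dual 1 0"

definition plus_dual_over :: "'a dual_over \<Rightarrow> 'a dual_over \<Rightarrow> 'a dual_over" where
  "p + q = Dual (std_part p + std_part q) (inf_part p + inf_part q)"

definition uminus_dual_over :: "'a dual_over \<Rightarrow> 'a dual_over" where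
  "- q = Dual (- std_part q) (- inf_part q)"

definition minus_dual_over :: "'a dual_over \<Rightarrow> 'a dual_over \<Rightarrow> 'a dual_over" where
  "p - q = Dual (std_part p - std_part q) (inf_part p - inf_part q)"

definition times_dual_over :: "'a dual_over \<Rightarrow> 'a dual_over \<Rightarrow> 'a dual_over" where
  "p * q = Dual (std_part p * std_part q)
                (std_part p * inf_part q + inf_part p * std_part q)"

instance
  by standard
    (simp_all add: zero_dual_over_def one_dual_over_def plus_dual_over_def
      uminus_dual_over_def minus_dual_over_def times_dual_over_def
      dual_over.expand algebra_simps)

end

definition dual_eps :: "'a::ring_1 dual_over" where
  "dual_eps = Dual 0 1"

lemma dual_eps_nonzero: "dual_eps \<noteq> (0 :: 'a::ring_1 dual_over)"
  by (simp add: dual_eps_def zero_dual_over_def)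

lemma dual_eps_square: "dual_eps * dual_eps = (0 :: 'a::ring_1 dual_over)"
  by (simp add: dual_eps_def zero_dual_over_def times_dual_over_def)

lemma dual_eps_commute: "dual_eps * q = q * dual_eps"
  by (simp add: dual_eps_def times_dual_over_def)

lemma Dual_eq: "Dual a b = Dual a 0 + Dual b 0 * dual_eps"
  by (simp add: dual_eps_def plus_dual_over_def times_dual_over_def)

instantiation dual_over :: (linorder) linorder
begin

definition less_eq_dual_over :: "'a dual_over \<Rightarrow> 'a dual_over \<Rightarrow> bool" where
  "p \<le> q \<longleftrightarrow> std_part p < std_part q \<or> std_part p = std_part q \<and> inf_part p \<le> inf_part q"

definition less_dual_over :: "'a dual_over \<Rightarrow> 'a dual_over \<Rightarrow> bool" where
  "p < q \<longleftrightarrow> std_part p < std_part q \<or> std_part p = std_part q \<and> inf_part p < inf_part q"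

instance
  by standard
    (auto simp: less_eq_dual_over_def less_dual_over_def intro: dual_over.expand)

end

definition dual_quat_of :: "dual_number \<Rightarrow> dual_quat" where
  "dual_quat_of p = Dual (quat_of_real (std_part p)) (quat_of_real (inf_part p))"

definition dual_cnj :: "dual_quat \<Rightarrow> dual_quat" where
  "dual_cnj q = Dual (quat_cnj (std_part q)) (quat_cnj (inf_part q))"


section \<open>Dual quaternion matrices\<close>

definition std_matrix :: "dual_quat ^ 'n ^ 'm \<Rightarrow> quat ^ 'n ^ 'm" where
  "std_matrix B = (\<chi> i j. std_part (B $ i $ j))"

definition dq_adjoint :: "dual_quat ^ 'n ^ 'm \<Rightarrow> dual_quat ^ 'm ^ 'n" where
  "dq_adjoint B = (\<chi> i j. dual_cnj (B $ j $ i))"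

definition dq_hermitian :: "dual_quat ^ 'n ^ 'n \<Rightarrow> bool" where
  "dq_hermitian A \<longleftrightarrow> dq_adjoint A = A"

text \<open>The scalar \<open>x\<^sup>* A x\<close>. Multiplication is not commutative, so the order of the
  factors matters.\<close>

definition dq_form :: "dual_quat ^ 'n ^ 'n \<Rightarrow> dual_quat ^ 'n \<Rightarrow> dual_quat" where
  "dq_form A x = (\<Sum>i\<in>UNIV. dual_cnj (x $ i) * (A *v x) $ i)"

text \<open>Only dual numbers are ordered, so the inequality \<open>x\<^sup>* A x \<ge> 0\<close> is read as: the
  dual quaternion \<open>x\<^sup>* A x\<close> is a dual number, and that dual number is nonnegative.\<close>

definition dq_psd_hermitian :: "dual_quat ^ 'n ^ 'n \<Rightarrow> bool" where
  "dq_psd_hermitian A \<longleftrightarrow>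
     dq_hermitian A \<and> (\<forall>x. \<exists>p. dq_form A x = dual_quat_of p \<and> 0 \<le> p)"

definition perfect_hermitian :: "dual_quat ^ 'n ^ 'n \<Rightarrow> bool" where
  "perfect_hermitian M \<longleftrightarrow>
     dq_psd_hermitian M \<and> (\<exists>L. dq_psd_hermitian L \<and> M = L ** L)"

end

theory Submission
  imports Defs
begin

text \<open>Write \<open>B = N + K \<epsilon>\<close>. The standard part \<open>N\<^sup>* N\<close> of \<open>A\<close> has a positive semidefinite
  square root \<open>L\<close>, which in turn is \<open>M\<^sup>2\<close> with \<open>M\<close> Hermitian. A square root \<open>L + X \<epsilon>\<close> of \<open>A\<close>
  requires the Sylvester equation \<open>L X + X L = N\<^sup>* K + K\<^sup>* N\<close>, which is solvable because its
  right-hand side is orthogonal to the kernel of the Sylvester operator. A solution of the form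
  \<open>X = L Y + Y L\<close> with \<open>Y\<close> Hermitian gives \<open>L + X \<epsilon> = D\<^sup>* D\<close> for \<open>D = M + M Y \<epsilon>\<close>, and every such
  Gram matrix is positive semidefinite.\<close>

section \<open>Quaternions as a Euclidean space\<close>

lemmas quat_comp_defs = zero_quat_def one_quat_def plus_quat_def uminus_quat_def minus_quat_def
  times_quat_def

lemma quat_sel [simp]:
  "q_re 0 = 0" "q_i 0 = 0" "q_j 0 = 0" "q_k 0 = 0"
  "q_re 1 = 1" "q_i 1 = 0" "q_j 1 = 0" "q_k 1 = 0"
  "q_re (p + q) = q_re p + q_re q" "q_i (p + q) = q_i p + q_i q"
  "q_j (p + q) = q_j p + q_j q" "q_k (p + q) = q_k p + q_k q"
  "q_re (- q) = - q_re q" "q_i (- q) = - q_i q" "q_j (- q) = - q_j q" "q_k (- q) = - q_k q"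
  "q_re (p - q) = q_re p - q_re q" "q_i (p - q) = q_i p - q_i q"
  "q_j (p - q) = q_j p - q_j q" "q_k (p - q) = q_k p - q_k q"
  "q_re (quat_cnj q) = q_re q" "q_i (quat_cnj q) = - q_i q"
  "q_j (quat_cnj q) = - q_j q" "q_k (quat_cnj q) = - q_k q"
  "q_re (quat_of_real r) = r" "q_i (quat_of_real r) = 0"
  "q_j (quat_of_real r) = 0" "q_k (quat_of_real r) = 0"
  by (simp_all add: quat_comp_defs quat_cnj_def quat_of_real_def)

lemma quat_sel_mult:
  "q_re (p * q) = q_re p * q_re q - q_i p * q_i q - q_j p * q_j q - q_k p * q_k q"
  "q_i (p * q) = q_re p * q_i q + q_i p * q_re q + q_j p * q_k q - q_k p * q_j q"
  "q_j (p * q) = q_re p * q_j q - q_i p * q_k q + q_j p * q_re q + q_k p * q_i q"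
  "q_k (p * q) = q_re p * q_k q + q_i p * q_j q - q_j p * q_i q + q_k p * q_re q"
  by (simp_all add: times_quat_def)

lemma quat_eq_iff:
  "p = q \<longleftrightarrow> q_re p = q_re q \<and> q_i p = q_i q \<and> q_j p = q_j q \<and> q_k p = q_k q"
  by (auto intro: quat.expand)

instantiation quat :: real_algebra_1
begin

definition scaleR_quat :: "real \<Rightarrow> quat \<Rightarrow> quat" where
  "scaleR r q = Quat (r * q_re q) (r * q_i q) (r * q_j q) (r * q_k q)"

instance
  by standard (simp_all add: scaleR_quat_def quat_eq_iff quat_sel_mult algebra_simps)

end

lemma quat_sel_scaleR [simp]:
  "q_re (r *\<^sub>R q) = r * q_re q" "q_i (r *\<^sub>R q) = r * q_i q"
  "q_j (r *\<^sub>R q) = r * q_j q" "q_k (r *\<^sub>R q) = r * q_k q"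
  by (simp_all add: scaleR_quat_def)

text \<open>The inner product is that of \<open>R^4\<close>, the real part of
  \<open>quat_cnj p * q\<close>. Quaternion vectors and matrices thereby become real Euclidean
  spaces, and on matrices \<open>inner\<close> is the real Frobenius product.\<close>

instantiation quat :: real_inner
begin

definition inner_quat :: "quat \<Rightarrow> quat \<Rightarrow> real" where
  "inner p q = q_re p * q_re q + q_i p * q_i q + q_j p * q_j q + q_k p * q_k q"

definition norm_quat :: "quat \<Rightarrow> real" where
  "norm (q :: quat) = sqrt (inner q q)"

definition sgn_quat :: "quat \<Rightarrow> quat" where
  "sgn (q :: quat) = q /\<^sub>R norm q"

definition dist_quat :: "quat \<Rightarrow> quat \<Rightarrow> real" where
  "dist (p :: quat) q = norm (p - q)"

definition uniformity_quat :: "(quat \<times> quat) filter" where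
  "uniformity_quat = (INF e\<in>{0 <..}. principal {(x, y). dist x y < e})"

definition open_quat :: "quat set \<Rightarrow> bool" where
  "open_quat U \<longleftrightarrow> (\<forall>x\<in>U. eventually (\<lambda>(x', y). x' = x \<longrightarrow> y \<in> U) uniformity)"

instance
proof
  fix x y z :: quat and r :: real
  show "inner x y = inner y x"
    by (simp add: inner_quat_def mult.commute)
  show "inner (x + y) z = inner x z + inner y z"
    by (simp add: inner_quat_def algebra_simps)
  show "inner (scaleR r x) y = r * inner x y"
    by (simp add: inner_quat_def algebra_simps)
  show "0 \<le> inner x x"
    by (simp add: inner_quat_def)
  show "inner x x = 0 \<longleftrightarrow> x = 0"
    by (auto simp: inner_quat_def quat_eq_iff add_nonneg_eq_0_iff)
qed (rule norm_quat_def sgn_quat_def dist_quat_def uniformity_quat_def open_quat_def)+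

end

instantiation quat :: euclidean_space
begin

definition Basis_quat :: "quat set" where
  "Basis_quat = {Quat 1 0 0 0, Quat 0 1 0 0, Quat 0 0 1 0, Quat 0 0 0 1}"

instance
proof
  show "(\<forall>u\<in>Basis. inner x u = 0) \<longleftrightarrow> x = 0" for x :: quat
    by (simp add: Basis_quat_def inner_quat_def quat_eq_iff[of x])
qed (auto simp: Basis_quat_def inner_quat_def)

end

lemma quat_cnj_simps [simp]:
  "quat_cnj 0 = 0" "quat_cnj (p + q) = quat_cnj p + quat_cnj q"
  "quat_cnj (p - q) = quat_cnj p - quat_cnj q"
  "quat_cnj (r *\<^sub>R q) = r *\<^sub>R quat_cnj q" "quat_cnj (quat_cnj q) = q"
  by (simp_all add: quat_eq_iff)

lemma quat_cnj_mult: "quat_cnj (p * q) = quat_cnj q * quat_cnj p"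
  by (simp add: quat_eq_iff quat_sel_mult algebra_simps)

lemma quat_cnj_sum: "quat_cnj (sum f S) = (\<Sum>i\<in>S. quat_cnj (f i))"
  by (induction S rule: infinite_finite_induct) auto

lemma inner_quat_mult_left: "inner (a * p) q = inner p (quat_cnj a * q)" for a p q :: quat
  by (simp add: inner_quat_def quat_sel_mult algebra_simps)

lemma inner_quat_cnj: "inner (quat_cnj p) (quat_cnj q) = inner p q"
  by (simp add: inner_quat_def)

lemma quat_cnj_mult_self: "quat_cnj q * q = quat_of_real (inner q q)"
  by (simp add: quat_eq_iff inner_quat_def quat_sel_mult algebra_simps)

lemma quat_of_real_sum: "quat_of_real (sum f S) = (\<Sum>i\<in>S. quat_of_real (f i))"
  by (induction S rule: infinite_finite_induct) (auto simp: quat_eq_iff)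

lemma quat_mult_of_real: "q * quat_of_real r = r *\<^sub>R q"
  by (simp add: quat_eq_iff quat_sel_mult)


section \<open>Adjoints of quaternion matrices\<close>

definition quat_adjoint :: "quat ^ 'n ^ 'm \<Rightarrow> quat ^ 'm ^ 'n" where
  "quat_adjoint A = (\<chi> i j. quat_cnj (A $ j $ i))"

lemma quat_adjoint_simps [simp]:
  "quat_adjoint (quat_adjoint A) = A"
  "quat_adjoint (A + B) = quat_adjoint A + quat_adjoint B"
  "quat_adjoint (A - B) = quat_adjoint A - quat_adjoint B"
  "quat_adjoint (r *\<^sub>R A) = r *\<^sub>R quat_adjoint A"
  by (simp_all add: quat_adjoint_def vec_eq_iff)

lemma quat_adjoint_mult: "quat_adjoint (A ** B) = quat_adjoint B ** quat_adjoint A"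
  by (simp add: quat_adjoint_def vec_eq_iff matrix_matrix_mult_def quat_cnj_sum quat_cnj_mult)

lemma inner_quat_adjoint: "inner (quat_adjoint X) (quat_adjoint Y) = inner X Y"
  unfolding inner_vec_def quat_adjoint_def
  by (simp add: inner_quat_cnj) (rule sum.swap)

lemma inner_matrix_vector_adjoint: "inner (A *v x) y = inner x (quat_adjoint A *v y)"
  for A :: "quat ^ 'n ^ 'm"
  unfolding inner_vec_def quat_adjoint_def matrix_vector_mult_def
  by (simp add: inner_sum_left inner_sum_right inner_quat_mult_left) (rule sum.swap)

lemma inner_matrix_mult_left: "inner (A ** X) Y = inner X (quat_adjoint A ** Y)"
  for A :: "quat ^ 'n ^ 'm" and X :: "quat ^ 'k ^ 'n"
proof -
  have "inner (A ** X) Y = (\<Sum>i\<in>UNIV. \<Sum>j\<in>UNIV. \<Sum>k\<in>UNIV. inner (X $ k $ j) (quat_cnj (A $ i $ k) * Y $ i $ j))"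
    by (simp add: inner_vec_def matrix_matrix_mult_def inner_sum_left inner_quat_mult_left)
  also have "\<dots> = (\<Sum>j\<in>UNIV. \<Sum>i\<in>UNIV. \<Sum>k\<in>UNIV. inner (X $ k $ j) (quat_cnj (A $ i $ k) * Y $ i $ j))"
    by (rule sum.swap)
  also have "\<dots> = (\<Sum>j\<in>UNIV. \<Sum>k\<in>UNIV. \<Sum>i\<in>UNIV. inner (X $ k $ j) (quat_cnj (A $ i $ k) * Y $ i $ j))"
    by (rule sum.cong[OF refl], rule sum.swap)
  also have "\<dots> = (\<Sum>k\<in>UNIV. \<Sum>j\<in>UNIV. \<Sum>i\<in>UNIV. inner (X $ k $ j) (quat_cnj (A $ i $ k) * Y $ i $ j))"
    by (rule sum.swap)
  also have "\<dots> = inner X (quat_adjoint A ** Y)"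
    by (simp add: inner_vec_def matrix_matrix_mult_def inner_sum_right quat_adjoint_def)
  finally show ?thesis .
qed

text \<open>Taking adjoints preserves \<open>inner\<close> and reverses products, which turns right
  multiplication into the left case.\<close>

lemma inner_matrix_mult_right: "inner (X ** A) Y = inner X (Y ** quat_adjoint A)"
  for A :: "quat ^ 'n ^ 'm" and X :: "quat ^ 'm ^ 'k"
  using inner_matrix_mult_left[of "quat_adjoint A" "quat_adjoint X" "quat_adjoint Y"]
    inner_quat_adjoint[of "X ** A" Y] inner_quat_adjoint[of X "Y ** quat_adjoint A"]
  by (simp add: quat_adjoint_mult)

lemma matrix_distrib:
  fixes A :: "quat ^ 'n ^ 'm" and C :: "quat ^ 'k ^ 'n"
  shows "(A + B) ** C = A ** C + B ** C" "(A - B) ** C = A ** C - B ** C"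
    "A ** (C + D) = A ** C + A ** D" "A ** (C - D) = A ** C - A ** D"
    "(r *\<^sub>R A) ** C = r *\<^sub>R (A ** C)" "A ** (r *\<^sub>R C) = r *\<^sub>R (A ** C)"
  by (simp_all add: vec_eq_iff matrix_matrix_mult_def sum.distrib sum_subtractf distrib_left
      distrib_right left_diff_distrib right_diff_distrib scaleR_sum_right)

lemma matrix_zero [simp]:
  fixes A :: "quat ^ 'n ^ 'm"
  shows "A ** (0 :: quat ^ 'k ^ 'n) = 0" "(0 :: quat ^ 'm ^ 'k) ** A = 0"
  by (simp_all add: vec_eq_iff matrix_matrix_mult_def)

lemma scaleR_matrix_vector: "(r *\<^sub>R A) *v x = r *\<^sub>R (A *v x)" for A :: "quat ^ 'n ^ 'm"
  by (simp add: vec_eq_iff matrix_vector_mult_def scaleR_sum_right)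


section \<open>Square roots of positive semidefinite quaternion matrices\<close>

text \<open>\<open>inner x (A *v x)\<close> is only the real part of the quaternion form of
  \<open>A\<close> at \<open>x\<close>; for Hermitian \<open>A\<close> that form is real, so nothing
  is lost.\<close>

definition quat_psd :: "quat ^ 'n ^ 'n \<Rightarrow> bool" where
  "quat_psd A \<longleftrightarrow> quat_adjoint A = A \<and> (\<forall>x. 0 \<le> inner x (A *v x))"

text \<open>Minimality of the form at \<open>v\<close> forces its first variation, in the direction \<open>A v\<close>, to
  vanish.\<close>

lemma quat_psd_null_vector:
  assumes "quat_psd A" "inner v (A *v v) = 0"
  shows "A *v v = 0"
proof (rule ccontr)
  assume nz: "A *v v \<noteq> 0"
  define w where "w = A *v v"
  define c where "c = inner w (A *v w)"
  have lin: "linear ((*v) A)" by simp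
  have sym: "inner v (A *v w) = inner w w"
    using assms(1) inner_matrix_vector_adjoint[of A v w] by (simp add: quat_psd_def w_def)
  have q: "0 \<le> 2 * t * inner w w + t\<^sup>2 * c" for t
  proof -
    have "0 \<le> inner (v + t *\<^sub>R w) (A *v (v + t *\<^sub>R w))"
      using assms(1) by (simp add: quat_psd_def)
    also have "\<dots> = 2 * t * inner w w + t\<^sup>2 * c"
      using assms(2) sym
      by (simp add: linear_add[OF lin] linear_scale[OF lin] c_def w_def[symmetric]
          power2_eq_square algebra_simps)
    finally show ?thesis .
  qed
  have ww: "inner w w > 0" using nz by (simp add: w_def)
  have c0: "c \<ge> 0" using assms(1) by (simp add: c_def quat_psd_def)
  \<comment> \<open>Close to the minimiser \<open>- inner w w / c\<close> of the quadratic; the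
    added 1 keeps the denominator positive when \<open>c = 0\<close>.\<close>
  define t where "t = - inner w w / (c + 1)"
  have "2 * t * inner w w + t\<^sup>2 * c = - (inner w w)\<^sup>2 * (c + 2) / (c + 1)\<^sup>2"
    using c0 by (simp add: t_def power2_eq_square divide_simps) algebra
  also have "\<dots> < 0" using ww c0 by (simp add: divide_neg_pos)
  finally show False using q[of t] by simp
qed

text \<open>Rayleigh quotient argument: \<open>v\<close> maximises the form of \<open>A\<close> on
  the unit sphere and \<open>l\<close> is the maximum. The form of
  \<open>l *\<^sub>R mat 1 - A\<close> is then nonnegative and zero at \<open>v\<close>, so this
  matrix annihilates \<open>v\<close>.\<close>

lemma quat_psd_eigenvector:
  fixes A :: "quat ^ 'n ^ 'n"
  assumes "quat_psd A" "A \<noteq> 0"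
  obtains v l where "l > 0" "inner v v = 1" "A *v v = l *\<^sub>R v"
proof -
  define S where "S = sphere (0 :: quat ^ 'n) 1"
  have lin: "linear ((*v) A)" by simp
  have "continuous_on S (\<lambda>x. inner x (A *v x))"
    using linear_continuous_on[OF lin[unfolded linear_conv_bounded_linear]]
    by (intro continuous_intros)
  moreover have "compact S" "S \<noteq> {}" by (auto simp: S_def)
  ultimately obtain v where v: "v \<in> S" and max: "\<And>x. x \<in> S \<Longrightarrow> inner x (A *v x) \<le> inner v (A *v v)"
    using continuous_attains_sup by metis
  define l where "l = inner v (A *v v)"
  have vv: "inner v v = 1" using v by (simp add: S_def norm_eq_sqrt_inner)
  have bound: "inner x (A *v x) \<le> l * inner x x" for x
  proof (cases "x = 0")
    case False
    define y where "y = x /\<^sub>R norm x"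
    have "inner y (A *v y) \<le> l" using max[of y] False by (simp add: S_def y_def l_def)
    moreover have "inner y (A *v y) = inner x (A *v x) / inner x x"
      by (simp add: y_def linear_scale[OF lin] divide_simps power2_norm_eq_inner[symmetric] power2_eq_square)
    ultimately show ?thesis using False by (simp add: divide_simps mult.commute split: if_splits)
  qed simp
  have one: "quat_adjoint (mat 1 :: quat ^ 'n ^ 'n) = mat 1"
    by (simp add: quat_adjoint_def mat_def vec_eq_iff quat_eq_iff)
  have act: "(l *\<^sub>R mat 1 - A) *v x = l *\<^sub>R x - A *v x" for x
    by (simp add: matrix_vector_mult_diff_rdistrib scaleR_matrix_vector)
  have "quat_psd (l *\<^sub>R mat 1 - A)"
    using assms(1) bound one by (simp add: quat_psd_def act inner_diff_right)
  moreover have "inner v ((l *\<^sub>R mat 1 - A) *v v) = 0"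
    using vv by (simp add: act inner_diff_right) (simp add: l_def)
  ultimately have "A *v v = l *\<^sub>R v"
    using quat_psd_null_vector act by fastforce
  moreover have "l > 0"
  \<comment> \<open>Otherwise \<open>bound\<close> makes the form nonpositive, hence identically
    zero, so every vector is null and \<open>A = 0\<close>.\<close>
  proof (rule ccontr)
    assume "\<not> l > 0"
    then have "inner x (A *v x) \<le> 0" for x
      using bound[of x] by (meson inner_ge_zero mult_nonpos_nonneg not_less order_trans)
    then have "inner x (A *v x) = 0" for x
      using assms(1) by (simp add: quat_psd_def order_antisym)
    then have "A *v x = 0" for x using quat_psd_null_vector assms(1) by blast
    then show False using assms(2) by (simp add: matrix_eq)
  qed
  ultimately show ?thesis using that vv by blast
qed

text \<open>The form at \<open>x\<close> is the squared norm of \<open>B *v x\<close>.\<close>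

lemma quat_psd_gram: "quat_psd (quat_adjoint B ** B)"
  unfolding quat_psd_def
  by (metis inner_ge_zero inner_matrix_vector_adjoint matrix_vector_mul_assoc quat_adjoint_mult
      quat_adjoint_simps(1))

text \<open>Induction on the rank: a positive eigenvalue \<open>l\<close> with unit eigenvector \<open>v\<close> is split off
  by the projection \<open>P = v v\<^sup>*\<close>, since \<open>A - l P\<close> is again positive semidefinite and vanishes
  on \<open>v\<close> in addition to the kernel of \<open>A\<close>.\<close>

lemma quat_psd_sqrt:
  fixes A :: "quat ^ 'n ^ 'n"
  assumes "quat_psd A"
  obtains L where "quat_psd L" "L ** L = A"
proof -
  have "\<exists>L. quat_psd L \<and> L ** L = A" using assms
  proof (induction "DIM(quat ^ 'n) - dim {x. A *v x = 0}" arbitrary: A rule: less_induct)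
    case (less A)
    note psd = \<open>quat_psd A\<close>
    show ?case
    proof (cases "A = 0")
      case True
      then show ?thesis using psd by (intro exI[of _ 0]) simp
    next
      case False
      obtain v l where l: "l > 0" and vv: "inner v v = 1" and ev: "A *v v = l *\<^sub>R v"
        using quat_psd_eigenvector[OF psd False] .
      define P where "P = (\<chi> i j. v $ i * quat_cnj (v $ j))"
      have P_act: "P *v x = (\<chi> i. v $ i * (\<Sum>j\<in>UNIV. quat_cnj (v $ j) * x $ j))" for x
        by (simp add: P_def vec_eq_iff matrix_vector_mult_def sum_distrib_left mult.assoc)
      have "(\<Sum>j\<in>UNIV. quat_cnj (v $ j) * v $ j) = quat_of_real 1"
        using vv by (simp add: quat_cnj_mult_self inner_vec_def flip: quat_of_real_sum)
      then have Pv: "P *v v = v" by (simp add: P_act quat_mult_of_real)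
      have PH: "quat_adjoint P = P"
        by (simp add: P_def quat_adjoint_def quat_cnj_mult)
      \<comment> \<open>A product with the rank-one \<open>P\<close> on the right depends only on
        the image of \<open>v\<close>; this yields \<open>PP\<close>, \<open>AP\<close> and later
        \<open>LP\<close>.\<close>
      have CP: "C ** P = (\<chi> i j. (C *v v) $ i * quat_cnj (v $ j))" for C :: "quat ^ 'n ^ 'n"
        by (simp add: P_def vec_eq_iff matrix_matrix_mult_def matrix_vector_mult_def
            sum_distrib_right mult.assoc)
      have PP: "P ** P = P" by (simp only: CP Pv) (simp add: P_def)
      have AP: "A ** P = l *\<^sub>R P" by (simp only: CP ev) (simp add: P_def vec_eq_iff)
      have AH: "quat_adjoint A = A" using psd by (simp add: quat_psd_def)
      have PA: "P ** A = l *\<^sub>R P"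
        using quat_adjoint_mult[of A P] by (simp add: AP AH PH)
      define A' where "A' = A - l *\<^sub>R P"
      \<comment> \<open>Written as a congruence of \<open>A\<close> by the Hermitian matrix
        \<open>mat 1 - P\<close>, \<open>A'\<close> inherits positivity from
        \<open>A\<close>.\<close>
      have A': "A' = (mat 1 - P) ** (A ** (mat 1 - P))"
        by (simp add: A'_def matrix_distrib AP PA PP)
      have "quat_adjoint (mat 1 - P) = mat 1 - P"
        by (simp add: PH) (simp add: quat_adjoint_def mat_def vec_eq_iff quat_eq_iff)
      then have "inner x (A' *v x) = inner ((mat 1 - P) *v x) (A *v ((mat 1 - P) *v x))" for x
        by (simp only: A' inner_matrix_vector_adjoint matrix_vector_mul_assoc)
      then have psd': "quat_psd A'"
        using psd by (simp add: quat_psd_def A'_def PH)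
      have A'v: "A' *v v = 0"
        by (simp add: A'_def matrix_vector_mult_diff_rdistrib scaleR_matrix_vector ev Pv)
      \<comment> \<open>\<open>P ** A\<close> is a nonzero multiple of \<open>P\<close>, so
        \<open>P\<close> vanishes on the kernel of \<open>A\<close>.\<close>
      have ker: "A' *v x = 0" if "A *v x = 0" for x
      proof -
        have "l *\<^sub>R (P *v x) = 0"
          using that by (simp add: PA flip: scaleR_matrix_vector) (simp add: that flip: PA matrix_vector_mul_assoc)
        then show ?thesis
          using that by (simp add: A'_def matrix_vector_mult_diff_rdistrib scaleR_matrix_vector)
      qed
      have sub: "subspace {x. C *v x = 0}" for C :: "quat ^ 'n ^ 'n"
        using linear_subspace_kernel[of "(*v) C"] by simp
      have "v \<notin> {x. A *v x = 0}" using ev l vv by auto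
      then have "{x. A *v x = 0} \<subset> {x. A' *v x = 0}"
        using ker A'v by auto
      then have "dim {x. A *v x = 0} < dim {x. A' *v x = 0}"
        by (intro dim_psubset) (metis sub span_eq_iff)
      moreover have "dim {x. A' *v x = 0} \<le> DIM(quat ^ 'n)"
        by (rule dim_subset_UNIV)
      ultimately obtain L where L: "quat_psd L" "L ** L = A'"
        using less.hyps[OF _ psd'] by (meson diff_less_mono2 less_le_trans)
      have LH: "quat_adjoint L = L" using L by (simp add: quat_psd_def)
      \<comment> \<open>\<open>L\<close> inherits the null vector \<open>v\<close> of its square, so
        \<open>L\<close> and \<open>P\<close> annihilate each other and the cross terms of the
        squared sum below vanish.\<close>
      have "inner (L *v v) (L *v v) = inner v (A' *v v)"
        by (simp add: inner_matrix_vector_adjoint LH matrix_vector_mul_assoc L(2))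
      then have Lv: "L *v v = 0" by (simp add: A'v)
      have LP: "L ** P = 0" by (simp add: CP Lv vec_eq_iff)
      have PL: "P ** L = 0"
        using quat_adjoint_mult[of L P] by (simp add: LP LH PH) (simp add: quat_adjoint_def vec_eq_iff)
      have "(L + sqrt l *\<^sub>R P) ** (L + sqrt l *\<^sub>R P) = A"
        using l by (simp add: matrix_distrib LP PL PP L(2)) (simp add: A'_def)
      moreover have "quat_psd (L + sqrt l *\<^sub>R P)"
      proof -
        have "quat_psd P" using quat_psd_gram[of P] by (simp add: PH PP)
        then show ?thesis using L(1) l
          by (simp add: quat_psd_def matrix_vector_mult_add_rdistrib scaleR_matrix_vector inner_add_right)
      qed
      ultimately show ?thesis by blast
    qed
  qed
  then show ?thesis using that by blast
qed


section \<open>The Sylvester equation\<close>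

text \<open>For self-adjoint \<open>T\<close> the kernel is the orthogonal complement of the range;
  in finite dimension, taking complements again recovers the range.\<close>

lemma symmetric_linear_range:
  fixes T :: "'a::euclidean_space \<Rightarrow> 'a"
  assumes "linear T" "\<And>x y. inner (T x) y = inner x (T y)"
    and "\<And>y. T y = 0 \<Longrightarrow> inner b y = 0"
  shows "b \<in> range T"
proof -
  have "adjoint T = T" using assms(2) by (intro adjoint_unique) simp
  then have "T -` {0} = (range T)\<^sup>\<bottom>"
    using ker_orthogonal_comp_adjoint[OF assms(1)] by simp
  then have "b \<in> (range T)\<^sup>\<bottom>\<^sup>\<bottom>"
    using assms(3) by (auto simp: orthogonal_comp_def orthogonal_def inner_commute)
  then show ?thesis
    using orthogonal_comp_self linear_subspace_image[OF assms(1)] subspace_UNIV by blast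
qed

text \<open>The Sylvester operator \<open>T Y = L Y + Y L\<close> is symmetric for the Frobenius inner product, and
  its kernel consists of the \<open>Y\<close> with \<open>M Y = Y M = 0\<close>, to which the right-hand side is
  orthogonal. Solving with \<open>T \<circ> T\<close> instead of \<open>T\<close> makes the solution of \<open>T X = R\<close> lie in the
  range of \<open>T\<close>.\<close>

lemma sylvester_solution:
  fixes M :: "quat ^ 'n ^ 'n" and N K :: "quat ^ 'n ^ 'm"
  assumes MH: "quat_adjoint M = M" and L: "L = M ** M" "L ** L = quat_adjoint N ** N"
  obtains Y where "quat_adjoint Y = Y"
    "L ** (L ** Y + Y ** L) + (L ** Y + Y ** L) ** L = quat_adjoint N ** K + quat_adjoint K ** N"
proof -
  define T where "T Y = L ** Y + Y ** L" for Y
  define R where "R = quat_adjoint N ** K + quat_adjoint K ** N"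
  have LH: "quat_adjoint L = L" by (simp add: L(1) quat_adjoint_mult MH)
  have linT: "linear T"
    by (rule linearI) (simp_all add: T_def matrix_distrib scaleR_add_right)
  have symT: "inner (T X) Y = inner X (T Y)" for X Y
    by (simp add: T_def inner_add inner_matrix_mult_left[of L] inner_matrix_mult_right[of X] LH)
  \<comment> \<open>Factoring \<open>L\<close> as \<open>M ** M\<close> turns
    \<open>inner Y (T Y)\<close> into a sum of two squared norms.\<close>
  have ker: "M ** Y = 0 \<and> Y ** M = 0" if "T Y = 0" for Y
  proof -
    have "inner (M ** Y) (M ** Y) + inner (Y ** M) (Y ** M) = inner Y (T Y)"
      by (simp add: T_def inner_add inner_matrix_mult_left[of M] inner_matrix_mult_right[of _ M]
          MH L(1) matrix_mul_assoc)
    then show ?thesis using that by (simp add: add_nonneg_eq_0_iff)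
  qed
  have perp: "inner R Y = 0" if "T Y = 0" for Y
  proof -
    have LY: "L ** Y = 0" "Y ** L = 0"
      using ker[OF that] by (simp_all add: L(1) matrix_mul_assoc) (simp flip: matrix_mul_assoc)
    \<comment> \<open>\<open>L ** L\<close> is the Gram matrix of \<open>N\<close>, so
      \<open>L ** Y = 0\<close> and \<open>Y ** L = 0\<close> force \<open>N ** Y = 0\<close> and
      \<open>Y ** quat_adjoint N = 0\<close>. Moving the factors \<open>N\<close> across
      \<open>inner R Y\<close> then makes both of its summands vanish.\<close>
    have "inner (N ** Y) (N ** Y) = inner Y (L ** (L ** Y))"
      by (simp add: inner_matrix_mult_left[of N] matrix_mul_assoc L(2))
    then have NY: "N ** Y = 0" by (simp add: LY)
    have "inner (Y ** quat_adjoint N) (Y ** quat_adjoint N) = inner Y ((Y ** L) ** L)"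
      by (simp add: inner_matrix_mult_right[of Y] L(2) flip: matrix_mul_assoc)
    then have YN: "Y ** quat_adjoint N = 0" by (simp add: LY)
    show ?thesis
      by (simp add: R_def inner_add inner_matrix_mult_left[of "quat_adjoint N"]
          inner_matrix_mult_right[of "quat_adjoint K" N] NY YN)
  qed
  \<comment> \<open>By symmetry the squared norm of \<open>T Y\<close> is
    \<open>inner Y (T (T Y))\<close>. Hence \<open>R\<close> is also orthogonal to the kernel of
    \<open>T \<circ> T\<close>.\<close>
  have kerTT: "T Y = 0" if "T (T Y) = 0" for Y
    using symT[of Y "T Y"] that by simp
  have "R \<in> range (T \<circ> T)"
    by (rule symmetric_linear_range)
      (auto simp: symT linear_compose[OF linT linT] dest: kerTT perp)
  then obtain Z where Z: "T (T Z) = R" by auto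
  have Tadj: "T (quat_adjoint X) = quat_adjoint (T X)" for X
    by (simp add: T_def quat_adjoint_mult LH add.commute)
  have RH: "quat_adjoint R = R" by (simp add: R_def quat_adjoint_mult add.commute)
  \<comment> \<open>\<open>T\<close> commutes with adjoints and \<open>R\<close> is Hermitian, so
    the Hermitian part of the solution \<open>Z\<close> is again a solution.\<close>
  define Y where "Y = (1/2) *\<^sub>R (Z + quat_adjoint Z)"
  have "T (T Y) = (1/2) *\<^sub>R (R + R)"
    by (simp add: Y_def linear_scale[OF linT] linear_add[OF linT] Tadj Z RH)
  then have "T (T Y) = R" by (simp flip: scaleR_2)
  moreover have "quat_adjoint Y = Y" by (simp add: Y_def add.commute)
  ultimately show ?thesis using that by (simp add: T_def R_def)
qed


section \<open>Dual quaternion matrices\<close>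

lemma dual_sel [simp]:
  "std_part 0 = 0" "inf_part 0 = 0"
  "std_part (p + q) = std_part p + std_part q" "inf_part (p + q) = inf_part p + inf_part q"
  "std_part (p * q) = std_part p * std_part q"
  "inf_part (p * q) = std_part p * inf_part q + inf_part p * std_part q"
  "std_part (dual_cnj r) = quat_cnj (std_part r)" "inf_part (dual_cnj r) = quat_cnj (inf_part r)"
  by (simp_all add: zero_dual_over_def plus_dual_over_def times_dual_over_def dual_cnj_def)

lemma dual_sum_sel [simp]:
  "std_part (sum f S) = (\<Sum>i\<in>S. std_part (f i))" "inf_part (sum f S) = (\<Sum>i\<in>S. inf_part (f i))"
  by (induction S rule: infinite_finite_induct) auto

lemma dual_eq_iff: "p = q \<longleftrightarrow> std_part p = std_part q \<and> inf_part p = inf_part q"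
  by (auto intro: dual_over.expand)

definition inf_matrix :: "dual_quat ^ 'n ^ 'm \<Rightarrow> quat ^ 'n ^ 'm" where
  "inf_matrix B = (\<chi> i j. inf_part (B $ i $ j))"

definition dual_matrix :: "quat ^ 'n ^ 'm \<Rightarrow> quat ^ 'n ^ 'm \<Rightarrow> dual_quat ^ 'n ^ 'm" where
  "dual_matrix X Y = (\<chi> i j. Dual (X $ i $ j) (Y $ i $ j))"

lemma dual_matrix_std_inf: "dual_matrix (std_matrix B) (inf_matrix B) = B"
  by (simp add: dual_matrix_def std_matrix_def inf_matrix_def)

lemma dual_matrix_mult:
  "dual_matrix X Y ** dual_matrix X' Y' = dual_matrix (X ** X') (X ** Y' + Y ** X')"
  by (simp add: dual_matrix_def matrix_matrix_mult_def vec_eq_iff dual_eq_iff sum.distrib)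

lemma dq_adjoint_dual_matrix:
  "dq_adjoint (dual_matrix X Y) = dual_matrix (quat_adjoint X) (quat_adjoint Y)"
  by (simp add: dq_adjoint_def dual_matrix_def quat_adjoint_def vec_eq_iff dual_eq_iff)

lemma dual_cnj_mult: "dual_cnj (p * q) = dual_cnj q * dual_cnj p"
  by (simp add: dual_eq_iff quat_cnj_mult)

lemma dual_cnj_sum: "dual_cnj (sum f S) = (\<Sum>i\<in>S. dual_cnj (f i))"
  by (simp add: dual_eq_iff quat_cnj_sum)

text \<open>The infinitesimal part of the product is a quaternion plus its conjugate, hence twice a
  real part.\<close>

lemma dual_cnj_mult_self:
  "dual_cnj q * q = dual_quat_of
     (Dual (inner (std_part q) (std_part q)) (2 * inner (std_part q) (inf_part q)))"
  by (simp add: dual_eq_iff dual_quat_of_def quat_cnj_mult_self)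
    (simp add: quat_eq_iff quat_sel_mult inner_quat_def algebra_simps)

lemma dual_quat_of_sum: "dual_quat_of (sum f S) = (\<Sum>i\<in>S. dual_quat_of (f i))"
  by (simp add: dual_eq_iff dual_quat_of_def quat_of_real_sum)

text \<open>With \<open>y = D *v x\<close> the form is the sum of the dual numbers
  \<open>dual_cnj (y $ j) * y $ j\<close>.\<close>

lemma dq_psd_hermitian_gram: "dq_psd_hermitian (dq_adjoint D ** D)"
proof -
  have "dq_hermitian (dq_adjoint D ** D)"
    by (simp add: dq_hermitian_def dq_adjoint_def matrix_matrix_mult_def vec_eq_iff dual_cnj_sum
        dual_cnj_mult) (simp add: dual_eq_iff)
  moreover have "\<exists>p. dq_form (dq_adjoint D ** D) x = dual_quat_of p \<and> 0 \<le> p" for x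
  proof -
    define y where "y = D *v x"
    define p where "p = (\<Sum>i\<in>UNIV. Dual (inner (std_part (y $ i)) (std_part (y $ i)))
      (2 * inner (std_part (y $ i)) (inf_part (y $ i))))"
    have "dq_form (dq_adjoint D ** D) x
        = (\<Sum>i\<in>UNIV. \<Sum>j\<in>UNIV. dual_cnj (x $ i) * (dual_cnj (D $ j $ i) * y $ j))"
      by (simp add: dq_form_def y_def flip: matrix_vector_mul_assoc)
        (simp add: matrix_vector_mult_def dq_adjoint_def sum_distrib_left)
    also have "\<dots> = (\<Sum>j\<in>UNIV. \<Sum>i\<in>UNIV. dual_cnj (x $ i) * (dual_cnj (D $ j $ i) * y $ j))"
      by (rule sum.swap)
    also have "\<dots> = (\<Sum>j\<in>UNIV. dual_cnj (y $ j) * y $ j)"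
      by (simp add: y_def matrix_vector_mult_def dual_cnj_sum dual_cnj_mult sum_distrib_right mult.assoc)
    also have "\<dots> = dual_quat_of p"
      by (simp add: p_def dual_quat_of_sum dual_cnj_mult_self)
    finally have form: "dq_form (dq_adjoint D ** D) x = dual_quat_of p" .
    have "0 \<le> p"
    \<comment> \<open>If all standard parts of \<open>y\<close> vanish, so do the infinitesimal
      parts of the summands and \<open>p = 0\<close>; otherwise the standard part of
      \<open>p\<close> is positive and decides the lexicographic order.\<close>
    proof (cases "\<forall>i. std_part (y $ i) = 0")
      case True
      then show ?thesis by (simp add: p_def less_eq_dual_over_def)
    next
      case False
      then have "0 < (\<Sum>i\<in>UNIV. inner (std_part (y $ i)) (std_part (y $ i)))"
        by (auto intro: sum_pos2)
      then show ?thesis by (simp add: p_def less_eq_dual_over_def)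
    qed
    with form show ?thesis by blast
  qed
  ultimately show ?thesis by (simp add: dq_psd_hermitian_def)
qed

theorem corollary5p2:
  fixes B :: "dual_quat ^ 'n ^ 'm" and A :: "dual_quat ^ 'n ^ 'n"
  assumes "std_matrix B \<noteq> 0"
    and "A = dq_adjoint B ** B"
  shows "perfect_hermitian A"
proof -
  define N where "N = std_matrix B"
  define K where "K = inf_matrix B"
  have A: "A = dual_matrix (quat_adjoint N ** N) (quat_adjoint N ** K + quat_adjoint K ** N)"
    unfolding assms(2) N_def K_def
    by (metis dual_matrix_std_inf dq_adjoint_dual_matrix dual_matrix_mult)
  obtain L where L: "quat_psd L" "L ** L = quat_adjoint N ** N"
    using quat_psd_sqrt[OF quat_psd_gram] .
  obtain M where M: "quat_psd M" "M ** M = L"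
    using quat_psd_sqrt[OF L(1)] .
  have MH: "quat_adjoint M = M" using M(1) by (simp add: quat_psd_def)
  obtain Y where YH: "quat_adjoint Y = Y"
    and Y: "L ** (L ** Y + Y ** L) + (L ** Y + Y ** L) ** L
      = quat_adjoint N ** K + quat_adjoint K ** N"
    using sylvester_solution[OF MH M(2)[symmetric] L(2)] .
  define D where "D = dual_matrix M (M ** Y)"
  \<comment> \<open>Since \<open>M\<close> and \<open>Y\<close> are Hermitian, the adjoint of
    \<open>M ** Y\<close> is \<open>Y ** M\<close>, and each outer \<open>M\<close> pairs with an
    inner one to form \<open>L\<close>.\<close>
  have "dq_adjoint D ** D = dual_matrix L (L ** Y + Y ** L)"
    by (simp add: D_def dq_adjoint_dual_matrix dual_matrix_mult quat_adjoint_mult MH YH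
        flip: M(2) matrix_mul_assoc)
  then have "(dq_adjoint D ** D) ** (dq_adjoint D ** D) = A"
    by (simp add: dual_matrix_mult A L(2) Y)
  then show ?thesis
    unfolding perfect_hermitian_def
    using dq_psd_hermitian_gram[of B] dq_psd_hermitian_gram[of D] assms(2) by metis
qed

end
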